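(* Let $G$ be a graph and let $n\ge 0$ be an integer. Let $v\in V(G)$ be such that for each $S\subseteq N_G(v)$ with $|S|\le n+1$ there exists a vertex $v_S\ne v$ satisfying $S\subseteq N_G(v_S)$. Then for all $k\le n$, if $\mathcal{N}(G-\{v\})$ is $k$-connected then $\mathcal{N}(G)$ is $k$-connected.
   Context: Graphs are finite, undirected, without loops or multiple edges. $N_G(v)$ is the set of vertices adjacent to $v$, and $G-\{v\}$ is the subgraph induced on $V(G)\setminus\{v\}$. The neighbourhood complex $\mathcal{N}(G)$ is the simplicial complex whose simplices are the subsets $\sigma\subseteq V(G)$ whose elements have a common neighbour in $G$. A nonempty topological space $X$ is $k$-connected if every map from $S^m$ to $X$ extends to a map from $D^{m+1}$ to $X$, for $m=0,1,\dots,k$. Connectivity of a simplicial complex refers to its geometric realization. *)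

theory Defs
  imports "HOL-Analysis.Analysis" "Graph_Theory.Digraph"
begin

text \<open>The locale \<^locale>\<open>graph\<close> is Graph_Theory's notion of a finite simple undirected graph: a
  symmetric digraph with finitely many vertices and arcs, no loops and no parallel arcs (an edge
  is a pair of opposite arcs).\<close>

definition neighbours :: "('a, 'b) pre_digraph \<Rightarrow> 'a \<Rightarrow> 'a set" where
  "neighbours G v = {u \<in> verts G. v \<rightarrow>\<^bsub>G\<^esub> u}"

text \<open>The empty set counts as a simplex as soon as the graph has a vertex; it contributes no point
  to the geometric realization below.\<close>

definition neighbourhood_complex :: "('a, 'b) pre_digraph \<Rightarrow> 'a set set" where
  "neighbourhood_complex G = {\<sigma>. \<sigma> \<subseteq> verts G \<and> (\<exists>w\<in>verts G. \<sigma> \<subseteq> neighbours G w)}"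

text \<open>Points of the realization are given by barycentric coordinates. The topology is that of
  coordinatewise convergence, which is the usual (weak) topology of the realization when, as
  for the neighbourhood complex of a finite graph, the complex is finite.\<close>

definition geometric_realization :: "'a set set \<Rightarrow> ('a \<Rightarrow> real) topology" where
  "geometric_realization K = subtopology (powertop_real UNIV)
     {x. (\<forall>w. 0 \<le> x w) \<and> finite {w. x w \<noteq> 0} \<and> {w. x w \<noteq> 0} \<in> K \<and> (\<Sum>w | x w \<noteq> 0. x w) = 1}"

text \<open>The closed unit disc \<open>D\<^sup>n\<close>, in the same coordinates as \<^const>\<open>nsphere\<close>: the boundary sphere of
  \<open>ndisc (Suc m)\<close> is \<open>nsphere m\<close>.\<close>

definition ndisc :: "nat \<Rightarrow> (nat \<Rightarrow> real) topology" where
  "ndisc n = subtopology (Euclidean_space n) {x. (\<Sum>i<n. (x i)\<^sup>2) \<le> 1}"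

text \<open>For negative \<open>k\<close> the condition on spheres is void and only nonemptiness remains, in accordance
  with the convention that \<open>(-1)\<close>-connected means nonempty.\<close>

definition k_connected_space :: "int \<Rightarrow> 'a topology \<Rightarrow> bool" where
  "k_connected_space k X \<longleftrightarrow> topspace X \<noteq> {} \<and>
     (\<forall>m. int m \<le> k \<longrightarrow>
       (\<forall>f. continuous_map (nsphere m) X f \<longrightarrow>
         (\<exists>g. continuous_map (ndisc (Suc m)) X g \<and> (\<forall>x\<in>topspace (nsphere m). g x = f x))))"

end

(* Approximate a map S^m -> |N(G)| simplicially on a triangulation T of the sphere, with vertex labels l.
   Simplices of T have at most m + 1 <= n + 1 vertices, so each simplex tau has a common neighbour
   w(tau) <> v of its labels. A chain c in T likewise has at most n + 1 elements, and the labels of the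
   vertices of its least simplex are common neighbours of w(c), so that w(c) has a common neighbour
   u(c) <> v. Then u is a simplicial map from the second barycentric subdivision of T to N(G - {v}).
   For a chain of chains with intersection containing tau, both the vertices u(c) and the labels
   l(i), i in tau, are neighbours of w(tau); hence u is contiguous to a simplicial approximation of
   the identity followed by l, and homotopic in |N(G)| to the given map.
   Only open stars are needed, so triangulations are replaced by families of nonnegative
   functions, the vertices whose functions are nonzero at a point playing the role of its carrier. *)
theory Submission
  imports Defs
begin

subsection \<open>Filling spheres in a realization\<close>

definition realization :: "'a set set \<Rightarrow> ('a \<Rightarrow> real) set" where
  "realization K =
     {x. (\<forall>w. 0 \<le> x w) \<and> finite {w. x w \<noteq> 0} \<and> {w. x w \<noteq> 0} \<in> K \<and> (\<Sum>w | x w \<noteq> 0. x w) = 1}"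

text \<open>The index counts ambient coordinates: \<open>unit_sphere (Suc m)\<close> is the sphere
  of dimension \<open>m\<close>, and \<open>unit_sphere 0\<close> is empty. Working with sets in
  place of abstract topologies makes \<open>continuous_on\<close> available.\<close>

definition unit_sphere :: "nat \<Rightarrow> (nat \<Rightarrow> real) set" where
  "unit_sphere d = {x. (\<forall>i\<ge>d. x i = 0) \<and> (\<Sum>i<d. (x i)\<^sup>2) = 1}"

definition unit_disc :: "nat \<Rightarrow> (nat \<Rightarrow> real) set" where
  "unit_disc d = {x. (\<forall>i\<ge>d. x i = 0) \<and> (\<Sum>i<d. (x i)\<^sup>2) \<le> 1}"

definition fillable :: "nat \<Rightarrow> 'a set set \<Rightarrow> ((nat \<Rightarrow> real) \<Rightarrow> 'a \<Rightarrow> real) \<Rightarrow> bool" where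
  "fillable d K f \<longleftrightarrow> (\<exists>g. continuous_on (unit_disc d) g \<and> g \<in> unit_disc d \<rightarrow> realization K \<and>
     (\<forall>x\<in>unit_sphere d. g x = f x))"

lemma continuous_on_coordinate [continuous_intros]: "continuous_on X (\<lambda>x :: 'i \<Rightarrow> real. x i)"
  by (rule continuous_on_subset[OF continuous_on_product_coordinates]) auto

lemma geometric_realization_eq: "geometric_realization K = top_of_set (realization K)"
  by (simp add: geometric_realization_def realization_def euclidean_product_topology)

lemma nsphere_eq: "nsphere m = top_of_set (unit_sphere (Suc m))"
  by (simp add: nsphere unit_sphere_def euclidean_product_topology lessThan_Suc_atMost
      Suc_le_eq conj_commute Collect_conj_eq)

lemma ndisc_eq: "ndisc d = top_of_set (unit_disc d)"
  by (simp add: ndisc_def Euclidean_space_def unit_disc_def euclidean_product_topology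
      subtopology_subtopology Collect_conj_eq)

lemma k_connected_space_geometric_realization:
  "k_connected_space k (geometric_realization K) \<longleftrightarrow> realization K \<noteq> {} \<and>
     (\<forall>m. int m \<le> k \<longrightarrow> (\<forall>f. continuous_on (unit_sphere (Suc m)) f \<longrightarrow>
       f \<in> unit_sphere (Suc m) \<rightarrow> realization K \<longrightarrow> fillable (Suc m) K f))"
  by (simp add: k_connected_space_def geometric_realization_eq nsphere_eq ndisc_eq fillable_def conj_assoc imp_conjL)

text \<open>Summing over one fixed finite set in place of the varying support makes the
  normalisation condition linear in \<open>x\<close>.\<close>

lemma realization_iff:
  assumes "finite A" "\<Union>K \<subseteq> A"
  shows "x \<in> realization K \<longleftrightarrow> (\<forall>w. 0 \<le> x w) \<and> {w. x w \<noteq> 0} \<in> K \<and> sum x A = 1"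
proof -
  have "finite {w. x w \<noteq> 0} \<and> (\<Sum>w | x w \<noteq> 0. x w) = sum x A" if "{w. x w \<noteq> 0} \<in> K"
  proof -
    have *: "{w. x w \<noteq> 0} \<subseteq> A" using that assms by blast
    then show ?thesis
      using assms(1) finite_subset by (auto intro!: sum.mono_neutral_left)
  qed
  then show ?thesis by (auto simp: realization_def)
qed

lemma realization_convex:
  assumes A: "finite A" "\<Union>K \<subseteq> A" and K: "\<And>\<sigma> \<tau>. \<sigma> \<in> K \<Longrightarrow> \<tau> \<subseteq> \<sigma> \<Longrightarrow> \<tau> \<in> K"
    and x: "x \<in> realization K" and y: "y \<in> realization K"
    and xy: "{w. x w \<noteq> 0} \<union> {w. y w \<noteq> 0} \<in> K" and st: "0 \<le> s" "0 \<le> t" "s + t = 1"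
  shows "(\<lambda>w. s * x w + t * y w) \<in> realization K"
proof -
  have "{w. s * x w + t * y w \<noteq> 0} \<in> K"
    by (rule K[OF xy]) auto
  moreover have "(\<Sum>w\<in>A. s * x w + t * y w) = 1"
    using x y st realization_iff[OF A] by (simp add: sum.distrib flip: sum_distrib_left)
  ultimately show ?thesis
    using x y st realization_iff[OF A] by auto
qed

text \<open>Where the two supports span a common simplex, the segment between the two values stays
  in the realization. The straight-line homotopy from \<open>f'\<close> to \<open>f\<close> is
  therefore available as a collar around a filling of \<open>f'\<close>.\<close>

lemma fillable_contiguous:
  assumes A: "finite A" "\<Union>K \<subseteq> A" and K: "\<And>\<sigma> \<tau>. \<sigma> \<in> K \<Longrightarrow> \<tau> \<subseteq> \<sigma> \<Longrightarrow> \<tau> \<in> K"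
    and f: "continuous_on (unit_sphere d) f" "f \<in> unit_sphere d \<rightarrow> realization K"
    and contig: "\<And>x. x \<in> unit_sphere d \<Longrightarrow> {w. f x w \<noteq> 0} \<union> {w. f' x w \<noteq> 0} \<in> K"
    and fill: "fillable d K f'"
  shows "fillable d K f"
proof -
  obtain g where g: "continuous_on (unit_disc d) g" "g \<in> unit_disc d \<rightarrow> realization K"
    and gf: "\<And>x. x \<in> unit_sphere d \<Longrightarrow> g x = f' x"
    using fill by (auto simp: fillable_def)
  define r :: "(nat \<Rightarrow> real) \<Rightarrow> real" where "r x = sqrt (\<Sum>i<d. (x i)\<^sup>2)" for x
  define u :: "(nat \<Rightarrow> real) \<Rightarrow> nat \<Rightarrow> real" where "u x = (\<lambda>i. x i / r x)" for x
  \<comment> \<open>The filling of \<open>f'\<close> is shrunk to the disc of radius 1/2; the shell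
    outside carries the homotopy, with the radius as time.\<close>
  define h where "h x = (if r x \<le> 1/2 then g (\<lambda>i. 2 * x i)
     else (\<lambda>w. (2 - 2 * r x) * g (u x) w + (2 * r x - 1) * f (u x) w))" for x
  have sub: "unit_sphere d \<subseteq> unit_disc d" by (auto simp: unit_sphere_def unit_disc_def)
  have cr: "continuous_on X r" for X
    unfolding r_def by (intro continuous_intros)
  have r2: "(r x)\<^sup>2 = (\<Sum>i<d. (x i)\<^sup>2)" for x
    unfolding r_def by (simp add: sum_nonneg)
  have r0: "0 \<le> r x" for x by (simp add: r_def sum_nonneg)
  have us: "u x \<in> unit_sphere d" if "x \<in> unit_disc d" "1/2 \<le> r x" for x
  proof -
    have "(\<Sum>i<d. (u x i)\<^sup>2) = (r x)\<^sup>2 / (r x)\<^sup>2"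
      by (simp add: u_def power_divide r2 flip: sum_divide_distrib)
    also have "\<dots> = 1" using that by simp
    finally show ?thesis using that by (simp add: unit_sphere_def unit_disc_def u_def)
  qed
  have r1: "r x \<le> 1" if "x \<in> unit_disc d" for x
    using that by (auto simp: r_def unit_disc_def)
  have dbl: "(\<lambda>i. 2 * x i) \<in> unit_disc d" if "x \<in> unit_disc d" "r x \<le> 1/2" for x
  proof -
    have "(r x)\<^sup>2 \<le> (1/2)\<^sup>2" using that(2) r0 by (rule power_mono)
    then have "(\<Sum>i<d. (2 * x i)\<^sup>2) \<le> 1"
      by (simp add: r2 power_mult_distrib power_divide flip: sum_distrib_left)
    then show ?thesis using that by (simp add: unit_disc_def)
  qed
  have cu: "continuous_on {x \<in> unit_disc d. 1/2 \<le> r x} u"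
    unfolding u_def by (intro continuous_intros cr) auto
  have cgu: "continuous_on {x \<in> unit_disc d. 1/2 \<le> r x} (\<lambda>x. g (u x))"
    by (rule continuous_on_compose2[OF g(1) cu]) (use us sub in auto)
  have cfu: "continuous_on {x \<in> unit_disc d. 1/2 \<le> r x} (\<lambda>x. f (u x))"
    by (rule continuous_on_compose2[OF f(1) cu]) (use us in auto)
  have "continuous_on (unit_disc d) h"
    unfolding h_def
  proof (rule continuous_on_cases_le)
    show "continuous_on {x \<in> unit_disc d. r x \<le> 1/2} (\<lambda>x. g (\<lambda>i. 2 * x i))"
      by (rule continuous_on_compose2[OF g(1)]) (use dbl in \<open>auto intro!: continuous_intros\<close>)
    show "continuous_on {x \<in> unit_disc d. 1/2 \<le> r x}
       (\<lambda>x w. (2 - 2 * r x) * g (u x) w + (2 * r x - 1) * f (u x) w)"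
      by (intro continuous_intros cr continuous_on_product_then_coordinatewise[OF cgu]
          continuous_on_product_then_coordinatewise[OF cfu])
    \<comment> \<open>At radius 1/2 the coefficients are 1 and 0, and \<open>u x\<close> is twice
      \<open>x\<close>.\<close>
    fix x :: "nat \<Rightarrow> real" assume *: "r x = 1/2"
    show "g (\<lambda>i. 2 * x i) = (\<lambda>w. (2 - 2 * r x) * g (u x) w + (2 * r x - 1) * f (u x) w)"
      unfolding u_def * by (simp add: mult.commute)
  qed (rule cr)
  moreover have "h x \<in> realization K" if x: "x \<in> unit_disc d" for x
  proof (cases "r x \<le> 1/2")
    case True
    then show ?thesis using g(2) dbl[OF x] by (auto simp: h_def)
  next
    case False
    then have ux: "u x \<in> unit_sphere d" using us x by simp
    have "(\<lambda>w. (2 - 2 * r x) * g (u x) w + (2 * r x - 1) * f (u x) w) \<in> realization K"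
    proof (rule realization_convex[OF A])
      show "{w. g (u x) w \<noteq> 0} \<union> {w. f (u x) w \<noteq> 0} \<in> K"
        using contig[OF ux] gf[OF ux] by (simp add: Un_commute)
    qed (use ux f(2) g(2) sub False r1[OF x] in \<open>auto intro: K\<close>)
    then show ?thesis using False by (simp add: h_def)
  qed
  moreover have "h x = f x" if x: "x \<in> unit_sphere d" for x
  proof -
    have "r x = 1" using x by (simp add: r_def unit_sphere_def)
    then show ?thesis by (simp add: h_def u_def)
  qed
  ultimately show ?thesis unfolding fillable_def by blast
qed

subsection \<open>Maps given by weights and vertex labels\<close>

text \<open>A finite partition of unity before normalisation: products of functions qualify without
  their sum having to be known.\<close>

definition weights :: "'x::topological_space set \<Rightarrow> 'i set \<Rightarrow> ('i \<Rightarrow> 'x \<Rightarrow> real) \<Rightarrow> bool" where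
  "weights S I a \<longleftrightarrow> finite I \<and> (\<forall>i\<in>I. continuous_on S (a i)) \<and>
     (\<forall>x\<in>S. (\<forall>i\<in>I. 0 \<le> a i x) \<and> (\<exists>i\<in>I. a i x \<noteq> 0))"

definition active :: "'i set \<Rightarrow> ('i \<Rightarrow> 'x \<Rightarrow> real) \<Rightarrow> 'x \<Rightarrow> 'i set" where
  "active I a x = {i \<in> I. a i x \<noteq> 0}"

text \<open>The normalised weights map into the simplex spanned by \<open>I\<close>; the linear
  extension of \<open>l\<close> follows. Weights of indices with equal labels add up.\<close>

definition weighted_map ::
    "'i set \<Rightarrow> ('i \<Rightarrow> 'x \<Rightarrow> real) \<Rightarrow> ('i \<Rightarrow> 'a) \<Rightarrow> 'x \<Rightarrow> 'a \<Rightarrow> real" where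
  "weighted_map I a l x = (\<lambda>w. (\<Sum>i | i \<in> I \<and> l i = w. a i x) / (\<Sum>i\<in>I. a i x))"

lemma weights_sum_pos: "weights S I a \<Longrightarrow> x \<in> S \<Longrightarrow> 0 < (\<Sum>i\<in>I. a i x)"
  unfolding weights_def by (smt (verit) sum_pos2)

lemma active_nonempty: "weights S I a \<Longrightarrow> x \<in> S \<Longrightarrow> active I a x \<noteq> {}"
  by (auto simp: weights_def active_def)

lemma finite_active: "weights S I a \<Longrightarrow> finite (active I a x)"
  by (auto simp: weights_def active_def)

lemma continuous_on_weighted_map:
  assumes "weights S I a" shows "continuous_on S (weighted_map I a l)"
  unfolding weighted_map_def
  by (intro continuous_intros) (use assms weights_sum_pos[OF assms] in \<open>force simp: weights_def\<close>)+

text \<open>Nonnegative weights cannot cancel when they are added under a common label.\<close>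

lemma weighted_map_support:
  assumes a: "weights S I a" and x: "x \<in> S"
  shows "{w. weighted_map I a l x w \<noteq> 0} = l ` active I a x"
proof -
  have "(\<Sum>i | i \<in> I \<and> l i = w. a i x) = 0 \<longleftrightarrow> (\<forall>i\<in>{i \<in> I. l i = w}. a i x = 0)" for w
    using a x by (intro sum_nonneg_eq_0_iff) (auto simp: weights_def)
  then show ?thesis
    using weights_sum_pos[OF a x] by (auto simp: weighted_map_def active_def)
qed

lemma weighted_map_in_realization:
  assumes A: "finite A" "\<Union>K \<subseteq> A" and a: "weights S I a" and x: "x \<in> S"
    and l: "l ` active I a x \<in> K"
  shows "weighted_map I a l x \<in> realization K"
proof -
  let ?f = "weighted_map I a l x"
  have supp: "{w. ?f w \<noteq> 0} \<subseteq> A"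
    unfolding weighted_map_support[OF a x] using l A by blast
  have fin: "finite I" using a by (simp add: weights_def)
  \<comment> \<open>Inactive indices may have labels outside \<open>A\<close>, so \<open>A\<close>
    is enlarged before the sum is grouped by labels.\<close>
  have "sum ?f A = sum ?f (A \<union> l ` I)"
    using supp A(1) fin by (intro sum.mono_neutral_left) auto
  also have "\<dots> = (\<Sum>w\<in>A \<union> l ` I. \<Sum>i | i \<in> I \<and> l i = w. a i x) / (\<Sum>i\<in>I. a i x)"
    by (simp add: weighted_map_def sum_divide_distrib)
  also have "\<dots> = (\<Sum>i\<in>I. a i x) / (\<Sum>i\<in>I. a i x)"
    using fin A(1) by (subst sum.group) auto
  finally have "sum ?f A = 1" using weights_sum_pos[OF a x] by simp
  moreover have "0 \<le> ?f w" for w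
    unfolding weighted_map_def using a x by (intro divide_nonneg_nonneg sum_nonneg) (auto simp: weights_def)
  ultimately show ?thesis
    using l by (simp add: realization_iff[OF A] weighted_map_support[OF a x])
qed

subsection \<open>Fine covers of the sphere of small multiplicity\<close>

text \<open>The barycentric coordinate of the lattice point \<open>p\<close> in Freudenthal's triangulation of \<open>\<real>\<^sup>d\<close> is
  positive at \<open>y\<close> iff all \<open>\<bar>p i - y i\<bar>\<close> and all differences of two \<open>p i - y i\<close> are less than \<open>1\<close>.\<close>

definition lattice_weight :: "nat \<Rightarrow> (nat \<Rightarrow> int) \<Rightarrow> (nat \<Rightarrow> real) \<Rightarrow> real" where
  "lattice_weight d p y = (\<Prod>i<d. max 0 (1 - \<bar>p i - y i\<bar>)) *
     (\<Prod>i<d. \<Prod>j<d. max 0 (1 - ((p i - y i) - (p j - y j))))"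

lemma lattice_weight_nonneg: "0 \<le> lattice_weight d p y"
  unfolding lattice_weight_def by (intro mult_nonneg_nonneg prod_nonneg ballI) auto

lemma lattice_weight_nonzero_iff:
  "lattice_weight d p y \<noteq> 0 \<longleftrightarrow>
     (\<forall>i<d. \<bar>p i - y i\<bar> < 1) \<and> (\<forall>i<d. \<forall>j<d. (p i - y i) - (p j - y j) < 1)"
proof -
  have pos: "max 0 s \<noteq> 0 \<longleftrightarrow> 0 < s" for s :: real
    by (auto simp: max_def)
  show ?thesis
    by (simp add: lattice_weight_def pos Ball_def)
qed

text \<open>Rounding each coordinate to a nearest integer leaves errors in an interval of length 1
  that is open at one end, so errors differ by less than 1. Rounding may leave the cube, hence the
  margin of 1 in the range.\<close>

lemma lattice_weight_active_exists:
  assumes "\<And>i. i < d \<Longrightarrow> \<bar>y i\<bar> \<le> real N"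
  shows "\<exists>p \<in> {..<d} \<rightarrow>\<^sub>E {- int N - 1..int N + 1}. lattice_weight d p y \<noteq> 0"
proof -
  define p where "p = restrict (\<lambda>i. \<lfloor>y i + 1/2\<rfloor>) {..<d}"
  have p: "p i - y i \<le> 1/2" "- 1/2 < p i - y i" if "i < d" for i
    using that by (simp_all add: p_def) linarith+
  have "p i \<in> {- int N - 1..int N + 1}" if "i < d" for i
    using p[OF that] assms[OF that] by auto
  then have "p \<in> {..<d} \<rightarrow>\<^sub>E {- int N - 1..int N + 1}"
    by (auto simp: p_def)
  moreover have "\<bar>p i - y i\<bar> < 1" if "i < d" for i
    using p[OF that] by linarith
  moreover have "(p i - y i) - (p j - y j) < 1" if "i < d" "j < d" for i j
    using p[of i] p[of j] that by linarith
  ultimately show ?thesis unfolding lattice_weight_nonzero_iff by blast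
qed

text \<open>The active lattice points form a chain for the coordinatewise order, and all of them agree in
  a coordinate where \<open>y\<close> is an integer.\<close>

lemma card_lattice_weight_active:
  assumes A: "A \<subseteq> {..<d} \<rightarrow>\<^sub>E B" and act: "\<And>p. p \<in> A \<Longrightarrow> lattice_weight d p y \<noteq> 0"
    and k: "k < d" "y k \<in> \<int>"
  shows "card A \<le> d"
proof -
  \<comment> \<open>The height of \<open>p\<close> in the chain: the number of coordinates in which
    \<open>p\<close> exceeds the floor of \<open>y\<close>, each by exactly 1.\<close>
  define h where "h p = (\<Sum>i<d. p i - \<lfloor>y i\<rfloor>)" for p :: "nat \<Rightarrow> int"
  have near: "0 \<le> p i - \<lfloor>y i\<rfloor>" "p i - \<lfloor>y i\<rfloor> \<le> 1" "i = k \<Longrightarrow> p i - \<lfloor>y i\<rfloor> = 0"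
    if p: "p \<in> A" and i: "i < d" for p i
  proof -
    have "\<bar>p i - y i\<bar> < 1" using act[OF p] i unfolding lattice_weight_nonzero_iff by blast
    then show "0 \<le> p i - \<lfloor>y i\<rfloor>" "p i - \<lfloor>y i\<rfloor> \<le> 1" by linarith+
    assume "i = k"
    then show "p i - \<lfloor>y i\<rfloor> = 0"
      using k \<open>\<bar>p i - y i\<bar> < 1\<close> by (auto elim!: Ints_cases)
  qed
  \<comment> \<open>Coordinate \<open>k\<close> contributes nothing, which leaves only
    \<open>d\<close> possible heights.\<close>
  have "h p \<in> {0..<int d}" if p: "p \<in> A" for p
  proof -
    have "h p = (\<Sum>i\<in>{..<d} - {k}. p i - \<lfloor>y i\<rfloor>)"
      unfolding h_def using near(3)[OF p] k by (simp add: sum.remove[of "{..<d}" k])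
    also have "\<dots> \<le> (\<Sum>i\<in>{..<d} - {k}. 1)"
      by (rule sum_mono) (use near(2)[OF p] in auto)
    also have "\<dots> < int d" using k by simp
    finally show ?thesis
      using near(1)[OF p] by (auto simp: h_def intro: sum_nonneg)
  qed
  moreover have "inj_on h A"
  proof (rule inj_onI)
    have eq: "p = q" if pA: "p \<in> A" and qA: "q \<in> A" and h: "h p = h q"
      and le: "\<And>i. i < d \<Longrightarrow> p i \<le> q i" for p q
    proof -
      have "(\<Sum>i<d. q i - p i) = 0" using h by (simp add: h_def sum_subtractf)
      then have "\<forall>i\<in>{..<d}. q i - p i = 0"
        using le by (subst (asm) sum_nonneg_eq_0_iff) auto
      then show "p = q"
        using pA qA A by (intro PiE_ext[of p "{..<d}" "\<lambda>_. B" q]) auto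
    qed
    fix p q assume pq: "p \<in> A" "q \<in> A" "h p = h q"
    have "(\<forall>i<d. p i \<le> q i) \<or> (\<forall>i<d. q i \<le> p i)"
    proof (rule ccontr)
      assume "\<not> ?thesis"
      then obtain i j where ij: "i < d" "j < d" "q i < p i" "p j < q j" by (auto simp: not_le)
      \<comment> \<open>Adding the two inequalities cancels \<open>y\<close> and bounds a sum of two
        positive integers strictly by 2.\<close>
      have "(p i - y i) - (p j - y j) < 1" "(q j - y j) - (q i - y i) < 1"
        using act[OF pq(1)] act[OF pq(2)] ij(1,2) unfolding lattice_weight_nonzero_iff by blast+
      then show False using ij(3,4) by linarith
    qed
    then show "p = q" using eq[of p q] eq[of q p] pq by auto
  qed
  ultimately have "card A \<le> card {0..<int d}"
    by (intro card_inj_on_le[of h]) auto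
  then show ?thesis by simp
qed

section \<open>Maximum norm and compactness of the sphere\<close>

primrec sup_norm :: "nat \<Rightarrow> (nat \<Rightarrow> real) \<Rightarrow> real" where
  "sup_norm 0 x = 0"
| "sup_norm (Suc d) x = max (sup_norm d x) \<bar>x d\<bar>"

lemma continuous_on_sup_norm: "continuous_on X (sup_norm d)"
proof (induction d)
  case (Suc d)
  then show ?case unfolding sup_norm.simps by (intro continuous_intros)
qed simp

lemma abs_le_sup_norm: "i < d \<Longrightarrow> \<bar>x i\<bar> \<le> sup_norm d x"
  by (induction d) (auto simp: less_Suc_eq)

lemma sup_norm_attained: "sup_norm d x \<noteq> 0 \<Longrightarrow> \<exists>i<d. sup_norm d x = \<bar>x i\<bar>"
  by (induction d) (auto simp: max_def less_Suc_eq split: if_splits)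

lemma sup_norm_pos: "x \<in> unit_sphere d \<Longrightarrow> 0 < sup_norm d x"
proof (rule ccontr)
  assume x: "x \<in> unit_sphere d" and "\<not> 0 < sup_norm d x"
  then have "x i = 0" if "i < d" for i using abs_le_sup_norm[OF that, of x] by simp
  then show False using x by (simp add: unit_sphere_def)
qed

lemma tendsto_fun_iff:
  fixes f :: "'c \<Rightarrow> 'i \<Rightarrow> 'b::topological_space"
  shows "(f \<longlongrightarrow> l) F \<longleftrightarrow> (\<forall>i. ((\<lambda>n. f n i) \<longlongrightarrow> l i) F)"
  using limitin_componentwise[of "\<lambda>_. euclidean" UNIV f l F]
  by (simp add: euclidean_product_topology)

text \<open>A closed subset of a product of intervals, which is compact by Tychonoff's
  theorem.\<close>

lemma compact_unit_sphere: "compact (unit_sphere d)"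
proof -
  have "compactin (powertop_real UNIV) (PiE UNIV (\<lambda>_. {-1..1}))"
    by (simp add: compactin_PiE)
  then have "compact (PiE UNIV (\<lambda>_. {-1..1}) :: (nat \<Rightarrow> real) set)"
    by (simp add: euclidean_product_topology)
  moreover have "closed (unit_sphere d)"
  proof -
    have "unit_sphere d = (\<Inter>i\<in>{d..}. {x. x i = 0}) \<inter> {x. (\<Sum>i<d. (x i)\<^sup>2) = 1}"
      by (auto simp: unit_sphere_def)
    then show ?thesis
      by (auto intro!: closed_INT closed_Int closed_Collect_eq continuous_intros)
  qed
  moreover have "unit_sphere d \<subseteq> PiE UNIV (\<lambda>_. {-1..1})"
  proof
    fix x assume x: "x \<in> unit_sphere d"
    have "\<bar>x i\<bar> \<le> 1" for i
    proof (cases "i < d")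
      case True
      then have "(x i)\<^sup>2 \<le> (\<Sum>i<d. (x i)\<^sup>2)" by (intro member_le_sum) auto
      then show ?thesis using x by (simp add: unit_sphere_def abs_square_le_1)
    qed (use x in \<open>simp add: unit_sphere_def\<close>)
    then show "x \<in> PiE UNIV (\<lambda>_. {-1..1})" by (auto simp: abs_le_iff)
  qed
  ultimately show ?thesis by (metis compact_Int_closed inf.absorb_iff2)
qed

text \<open>The sphere is projected radially to the boundary of a cube, subdivided by lattice points
  at scale \<open>1/N\<close>. A Lebesgue number argument for the open sets where a coordinate of
  \<open>f\<close> is nonzero yields \<open>N\<close>, and \<open>l\<close> selects one such
  coordinate for each star.\<close>

lemma sphere_approximation:
  assumes f: "continuous_on (unit_sphere d) f" "f \<in> unit_sphere d \<rightarrow> realization K"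
  obtains I :: "(nat \<Rightarrow> int) set" and a l
  where "weights (unit_sphere d) I a"
    and "\<And>x. x \<in> unit_sphere d \<Longrightarrow> card (active I a x) \<le> d"
    and "\<And>x. x \<in> unit_sphere d \<Longrightarrow> l ` active I a x \<subseteq> {w. f x w \<noteq> 0}"
proof -
  \<comment> \<open>Radial projection to the boundary of the cube with coordinates between -1 and
    1.\<close>
  define q where "q x i = x i / sup_norm d x" for x :: "nat \<Rightarrow> real" and i :: nat
  let ?act = "\<lambda>N p x. lattice_weight d p (\<lambda>i. real N * q x i) \<noteq> 0"
  have q: "continuous_on (unit_sphere d) (\<lambda>x. q x i)" for i
    unfolding q_def by (intro continuous_intros continuous_on_sup_norm) (metis sup_norm_pos less_irrefl)
  have q_norm: "(\<Sum>i<d. (q x i)\<^sup>2) = 1 / (sup_norm d x)\<^sup>2" if "x \<in> unit_sphere d" for x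
    using that by (simp add: q_def power_divide unit_sphere_def flip: sum_divide_distrib)
  \<comment> \<open>Euclidean normalisation inverts the projection; it will carry limits back from
    the cube to the sphere.\<close>
  have q_inv: "x i = q x i / sqrt (\<Sum>i<d. (q x i)\<^sup>2)" if "x \<in> unit_sphere d" for x i
    using sup_norm_pos[OF that] by (simp add: q_norm[OF that] real_sqrt_divide) (simp add: q_def)
  have "\<exists>N\<ge>1. \<forall>p. \<exists>w. \<forall>x\<in>unit_sphere d. ?act N p x \<longrightarrow> f x w \<noteq> 0"
  proof (rule ccontr)
    assume "\<not> ?thesis"
    then have "\<forall>n. \<exists>p. \<forall>w. \<exists>x\<in>unit_sphere d. ?act (Suc n) p x \<and> f x w = 0"
      by (metis le_add1 plus_1_eq_Suc)
    then obtain p X where X: "\<And>n w. X n w \<in> unit_sphere d" "\<And>n w. ?act (Suc n) (p n) (X n w)"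
        "\<And>n w. f (X n w) w = 0"
      by metis
    \<comment> \<open>\<open>X n w\<close> shows that the star of \<open>p n\<close> is not
      contained in the open set of label \<open>w\<close>. The point for the arbitrary label
      \<open>undefined\<close> serves as a reference point of that star and provides the limit
      \<open>z\<close>.\<close>
    obtain z r where z: "z \<in> unit_sphere d" "strict_mono r" "((\<lambda>n. X n undefined) \<circ> r) \<longlonglongrightarrow> z"
      by (rule seq_compactE[OF compact_imp_seq_compact[OF compact_unit_sphere], of "\<lambda>n. X n undefined" d])
        (use X(1) in auto)
    have "(\<Sum>w | f z w \<noteq> 0. f z w) = 1"
      using f(2) z(1) by (auto simp: realization_def)
    then have "{w. f z w \<noteq> 0} \<noteq> {}" by (metis sum.empty zero_neq_one)
    then obtain w where w: "f z w \<noteq> 0" by blast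
    have lim: "(\<lambda>n. g (X (r n) undefined)) \<longlonglongrightarrow> g z" if "continuous_on (unit_sphere d) g" for g :: "_ \<Rightarrow> real"
      using continuous_on_tendsto_compose[OF that z(3)] z(1) X(1) by (simp add: o_def)
    have qz: "(\<lambda>n. q (X (r n) w) i) \<longlonglongrightarrow> q z i" if i: "i < d" for i
    proof -
      \<comment> \<open>Both points lie in the star of the lattice point \<open>p (r n)\<close>, so
        their scaled coordinates are each within 1 of it.\<close>
      have "\<bar>q (X (r n) w) i - q (X (r n) undefined) i\<bar> \<le> 2 / real (Suc n)" for n
      proof -
        have "\<bar>p (r n) i - real (Suc (r n)) * q (X (r n) y) i\<bar> < 1" for y
          using X(2)[of "r n" y] i unfolding lattice_weight_nonzero_iff by blast
        from this[of w] this[of undefined]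
        have "\<bar>real (Suc (r n)) * q (X (r n) w) i - real (Suc (r n)) * q (X (r n) undefined) i\<bar> \<le> 2"
          by linarith
        then have "real (Suc (r n)) * \<bar>q (X (r n) w) i - q (X (r n) undefined) i\<bar> \<le> 2"
          by (simp add: abs_mult flip: right_diff_distrib)
        moreover have "real (Suc n) \<le> real (Suc (r n))"
          using seq_suble[OF z(2), of n] by simp
        ultimately have "real (Suc n) * \<bar>q (X (r n) w) i - q (X (r n) undefined) i\<bar> \<le> 2"
          by (meson abs_ge_zero mult_right_mono order_trans)
        then show ?thesis by (simp add: pos_le_divide_eq mult.commute)
      qed
      then have "\<forall>\<^sub>F n in sequentially. norm (q (X (r n) w) i - q (X (r n) undefined) i) \<le> 2 / real (Suc n)"
        by (intro always_eventually allI) (simp only: real_norm_def)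
      then have "(\<lambda>n. q (X (r n) w) i - q (X (r n) undefined) i) \<longlonglongrightarrow> 0"
        by (rule Lim_null_comparison) (rule LIMSEQ_Suc[OF lim_const_over_n])
      from tendsto_add[OF this lim[OF q[of i]]] show ?thesis by simp
    qed
    have "(\<lambda>n. X (r n) w i) \<longlonglongrightarrow> z i" for i
    proof (cases "i < d")
      case True
      have "(\<lambda>n. q (X (r n) w) i / sqrt (\<Sum>i<d. (q (X (r n) w) i)\<^sup>2)) \<longlonglongrightarrow> q z i / sqrt (\<Sum>i<d. (q z i)\<^sup>2)"
        using sup_norm_pos[OF z(1)] by (intro tendsto_intros qz True) (auto simp: q_norm[OF z(1)])
      then show ?thesis by (simp flip: q_inv[OF X(1)] q_inv[OF z(1)])
    next
      case False
      then have "X (r n) w i = 0" "z i = 0" for n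
        using X(1)[of "r n" w] z(1) by (auto simp: unit_sphere_def)
      then show ?thesis by simp
    qed
    then have "(\<lambda>n. X (r n) w) \<longlonglongrightarrow> z" by (simp add: tendsto_fun_iff)
    \<comment> \<open>Coordinate \<open>w\<close> of \<open>f\<close> vanishes along the sequence
      but not at its limit \<open>z\<close>.\<close>
    from continuous_on_tendsto_compose[OF continuous_on_product_then_coordinatewise[OF f(1)] this]
    have "(\<lambda>n. f (X (r n) w) w) \<longlonglongrightarrow> f z w"
      using z(1) X(1) by simp
    with X(3) w show False by (simp add: LIMSEQ_const_iff)
  qed
  then obtain N where N: "N \<ge> 1" "\<forall>p. \<exists>w. \<forall>x\<in>unit_sphere d. ?act N p x \<longrightarrow> f x w \<noteq> 0"
    by blast
  then obtain l where l: "\<And>p x. x \<in> unit_sphere d \<Longrightarrow> ?act N p x \<Longrightarrow> f x (l p) \<noteq> 0"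
    by metis
  define I where "I = {..<d} \<rightarrow>\<^sub>E {- int N - 1..int N + 1}"
  define a where "a p x = lattice_weight d p (\<lambda>i. real N * q x i)" for p x
  have qN: "\<bar>real N * q x i\<bar> \<le> real N" if "x \<in> unit_sphere d" "i < d" for x i
    using abs_le_sup_norm[OF that(2), of x] sup_norm_pos[OF that(1)]
    by (simp add: abs_mult q_def divide_le_eq mult_left_mono)
  show thesis
  proof
    have "finite I" by (simp add: I_def finite_PiE)
    moreover have "continuous_on (unit_sphere d) (a p)" for p
      unfolding a_def lattice_weight_def by (intro continuous_intros q)
    ultimately show "weights (unit_sphere d) I a"
      using lattice_weight_active_exists[OF qN]
      by (auto simp: weights_def a_def I_def lattice_weight_nonneg)
  next
    fix x assume x: "x \<in> unit_sphere d"
    then obtain k where k: "k < d" "sup_norm d x = \<bar>x k\<bar>"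
      using sup_norm_attained sup_norm_pos by (metis less_irrefl)
    then have "q x k = 1 \<or> q x k = -1"
      using sup_norm_pos[OF x] by (auto simp: q_def abs_if split: if_splits)
    \<comment> \<open>Because \<open>N\<close> is an integer, the face of the cube containing
      \<open>q x\<close> supplies the integral coordinate needed for the bound
      \<open>d\<close>.\<close>
    then have "real N * q x k \<in> \<int>" by auto
    then show "card (active I a x) \<le> d"
      using k(1) by (intro card_lattice_weight_active[of _ d "{- int N - 1..int N + 1}" "\<lambda>i. real N * q x i" k])
        (auto simp: active_def a_def I_def)
    show "l ` active I a x \<subseteq> {w. f x w \<noteq> 0}"
      using l[OF x] by (auto simp: active_def a_def)
  qed
qed

subsection \<open>Barycentric subdivision of weights\<close>

text \<open>Nonzero exactly where the point lies in the open star of the vertex \<open>\<tau>\<close> of the barycentric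
  subdivision.\<close>

definition sd_weight :: "'i set \<Rightarrow> ('i \<Rightarrow> 'x \<Rightarrow> real) \<Rightarrow> 'i set \<Rightarrow> 'x \<Rightarrow> real" where
  "sd_weight I a \<tau> x = (\<Prod>i\<in>\<tau>. a i x * (\<Prod>j\<in>I - \<tau>. max 0 (a i x - a j x)))"

lemma sd_weight_nonzero_iff:
  assumes "finite I" "\<And>i. i \<in> I \<Longrightarrow> 0 \<le> a i x" "\<tau> \<subseteq> I"
  shows "sd_weight I a \<tau> x \<noteq> 0 \<longleftrightarrow> (\<forall>i\<in>\<tau>. 0 < a i x \<and> (\<forall>j\<in>I - \<tau>. a j x < a i x))"
proof -
  have "finite \<tau>" using assms finite_subset by blast
  then have "sd_weight I a \<tau> x \<noteq> 0 \<longleftrightarrow>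
      (\<forall>i\<in>\<tau>. a i x \<noteq> 0 \<and> (\<forall>j\<in>I - \<tau>. max 0 (a i x - a j x) \<noteq> 0))"
    using assms(1) by (simp add: sd_weight_def)
  moreover have "a i x \<noteq> 0 \<longleftrightarrow> 0 < a i x" if "i \<in> \<tau>" for i
    using assms(2)[of i] assms(3) that by (auto simp: order_less_le)
  moreover have "max 0 (s - t) \<noteq> 0 \<longleftrightarrow> t < s" for s t :: real
    by (auto simp: max_def)
  ultimately show ?thesis by simp
qed

lemma weights_sd:
  assumes "weights S I a" shows "weights S (Pow I - {{}}) (sd_weight I a)"
proof -
  have fin: "finite I" and a: "\<And>i x. i \<in> I \<Longrightarrow> x \<in> S \<Longrightarrow> 0 \<le> a i x"
    and ne: "\<And>x. x \<in> S \<Longrightarrow> \<exists>i\<in>I. a i x \<noteq> 0"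
    using assms by (auto simp: weights_def)
  have "continuous_on S (sd_weight I a \<tau>)" if "\<tau> \<subseteq> I" for \<tau>
    unfolding sd_weight_def
    by (intro continuous_intros) (use assms that in \<open>auto simp: weights_def\<close>)
  moreover have "0 \<le> sd_weight I a \<tau> x" if "\<tau> \<subseteq> I" "x \<in> S" for \<tau> x
    unfolding sd_weight_def by (intro prod_nonneg mult_nonneg_nonneg ballI) (use a that in auto)
  moreover have "\<exists>\<tau>\<in>Pow I - {{}}. sd_weight I a \<tau> x \<noteq> 0" if x: "x \<in> S" for x
  proof -
    obtain k where k: "k \<in> I" "a k x \<noteq> 0" using ne x by blast
    define M where "M = Max ((\<lambda>i. a i x) ` I)"
    \<comment> \<open>The indices of maximal weight always form an active set.\<close>
    define \<tau> where "\<tau> = {i \<in> I. a i x = M}"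
    have le: "a i x \<le> M" if "i \<in> I" for i
      using fin that by (auto simp: M_def)
    have "M \<in> (\<lambda>i. a i x) ` I"
      unfolding M_def using fin k by (intro Max_in) auto
    then have "\<tau> \<noteq> {}" by (auto simp: \<tau>_def)
    moreover have "0 < M" using k le[OF k(1)] a[OF k(1) x] by linarith
    ultimately show ?thesis
      using le a[OF _ x] fin
      by (intro bexI[of _ \<tau>]) (auto simp: sd_weight_nonzero_iff \<tau>_def order_less_le)
  qed
  ultimately show ?thesis using fin by (auto simp: weights_def)
qed

lemma active_sd_subset:
  assumes "weights S I a" "x \<in> S" "\<tau> \<in> active (Pow I - {{}}) (sd_weight I a) x"
  shows "\<tau> \<noteq> {}" "\<tau> \<subseteq> active I a x"
  using assms sd_weight_nonzero_iff[of I a x \<tau>] by (auto simp: active_def weights_def)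

text \<open>Each active set is an upper level set of the weights: for incomparable sets, an index
  private to one and an index private to the other would each have the larger weight.\<close>

lemma active_sd_chain:
  assumes "weights S I a" "x \<in> S"
  shows "subset.chain UNIV (active (Pow I - {{}}) (sd_weight I a) x)"
proof -
  have "\<sigma> \<subseteq> \<tau> \<or> \<tau> \<subseteq> \<sigma>"
    if "\<sigma> \<in> active (Pow I - {{}}) (sd_weight I a) x" "\<tau> \<in> active (Pow I - {{}}) (sd_weight I a) x" for \<sigma> \<tau>
  proof -
    have "\<sigma> \<subseteq> I" "\<tau> \<subseteq> I" "\<forall>i\<in>\<sigma>. \<forall>j\<in>I - \<sigma>. a j x < a i x" "\<forall>i\<in>\<tau>. \<forall>j\<in>I - \<tau>. a j x < a i x"
      using that assms sd_weight_nonzero_iff[of I a x] by (auto simp: active_def weights_def)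
    note facts = this
    show ?thesis
    proof (rule ccontr)
      assume "\<not> ?thesis"
      then obtain i j where "i \<in> \<sigma>" "i \<notin> \<tau>" "j \<in> \<tau>" "j \<notin> \<sigma>" by blast
      then have "a j x < a i x" "a i x < a j x" using facts by blast+
      then show False by simp
    qed
  qed
  then show ?thesis by (simp add: subset_chain_def)
qed

text \<open>Cardinality is injective on a chain of finite sets; nonemptiness excludes the value 0
  and thereby saves one.\<close>

lemma card_chain_le:
  assumes "finite s" "subset.chain UNIV C" "\<And>\<tau>. \<tau> \<in> C \<Longrightarrow> \<tau> \<noteq> {} \<and> \<tau> \<subseteq> s"
  shows "card C \<le> card s"
proof -
  have fin: "finite \<tau>" if "\<tau> \<in> C" for \<tau> using assms that finite_subset by blast
  have "inj_on card C"
    using assms(2) fin by (intro inj_onI) (metis card_subset_eq subset_chain_def)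
  moreover have "card ` C \<subseteq> {1..card s}"
    using assms(3) fin card_mono[OF assms(1)] by (force simp: Suc_le_eq card_gt_0_iff)
  ultimately show ?thesis by (metis card_atLeastAtMost card_inj_on_le diff_Suc_1 finite_atLeastAtMost)
qed

text \<open>The first fact keeps the multiplicity bound under subdivision; the second provides the
  least simplex of a chain.\<close>

lemma active_sd:
  assumes "weights S I a" "x \<in> S"
  shows "card (active (Pow I - {{}}) (sd_weight I a) x) \<le> card (active I a x)"
    and "\<C> \<subseteq> active (Pow I - {{}}) (sd_weight I a) x \<Longrightarrow> \<C> \<noteq> {} \<Longrightarrow> \<Inter>\<C> \<in> \<C>"
proof -
  let ?A = "active (Pow I - {{}}) (sd_weight I a) x"
  show "card ?A \<le> card (active I a x)"
    by (rule card_chain_le[OF finite_active[OF assms(1)] active_sd_chain[OF assms]])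
      (use active_sd_subset[OF assms] in blast)
  assume C: "\<C> \<subseteq> ?A" "\<C> \<noteq> {}"
  have "finite \<C>" using C(1) finite_active[OF weights_sd[OF assms(1)]] finite_subset by blast
  moreover have "subset.chain UNIV \<C>"
    using active_sd_chain[OF assms] C(1) by (auto simp: subset_chain_def)
  ultimately show "\<Inter>\<C> \<in> \<C>" using C(2) Inter_in_chain by blast
qed

subsection \<open>Avoiding a vertex\<close>

text \<open>The set \<open>U\<close> restricts both the simplices and their common neighbours, so
  shrinking \<open>U\<close> under a fixed relation models vertex deletion.\<close>

definition common_nbr_complex :: "('a \<Rightarrow> 'a \<Rightarrow> bool) \<Rightarrow> 'a set \<Rightarrow> 'a set set" where
  "common_nbr_complex adj U = {\<sigma>. \<sigma> \<subseteq> U \<and> (\<exists>w\<in>U. \<forall>u\<in>\<sigma>. adj w u)}"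

text \<open>The index set \<open>J\<close> consists of the vertices of the second subdivision. The
  labelling \<open>l'\<close> is the intermediary: contiguous to \<open>u\<close> on one side, and
  using only labels already given by \<open>l\<close> on the other.\<close>

lemma avoid_vertex:
  fixes adj :: "'a \<Rightarrow> 'a \<Rightarrow> bool" and V :: "'a set" and v :: 'a and I :: "'i set"
  assumes sym: "\<And>u w. adj u w \<Longrightarrow> adj w u"
    and repl: "\<And>T. T \<subseteq> V \<Longrightarrow> \<forall>u\<in>T. adj v u \<Longrightarrow> card T \<le> N \<Longrightarrow> \<exists>w\<in>V - {v}. \<forall>u\<in>T. adj w u"
    and a: "weights S I a"
    and card: "\<And>x. x \<in> S \<Longrightarrow> card (active I a x) \<le> N"
    and l: "\<And>x. x \<in> S \<Longrightarrow> l ` active I a x \<in> common_nbr_complex adj V"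
  obtains J :: "'i set set set" and b u l'
  where "weights S J b"
    and "\<And>x. x \<in> S \<Longrightarrow> u ` active J b x \<in> common_nbr_complex adj (V - {v})"
    and "\<And>x. x \<in> S \<Longrightarrow> l' ` active J b x \<union> u ` active J b x \<in> common_nbr_complex adj V"
    and "\<And>x. x \<in> S \<Longrightarrow> l' ` active J b x \<subseteq> l ` active I a x"
proof -
  define com where "com T = (SOME w. w \<in> V - {v} \<and> (\<forall>u\<in>T. adj w u))" for T
  have com: "com T \<in> V - {v}" "\<And>u. u \<in> T \<Longrightarrow> adj (com T) u" if T: "T \<in> common_nbr_complex adj V" "card T \<le> N" for T
  proof -
    \<comment> \<open>Either the common neighbour of \<open>T\<close> given by the complex differs
      from \<open>v\<close>, or \<open>T\<close> consists of neighbours of \<open>v\<close> and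
      \<open>repl\<close> applies.\<close>
    have "\<exists>w. w \<in> V - {v} \<and> (\<forall>u\<in>T. adj w u)"
      using T repl[of T] unfolding common_nbr_complex_def by blast
    from someI_ex[OF this] show "com T \<in> V - {v}" "\<And>u. u \<in> T \<Longrightarrow> adj (com T) u"
      unfolding com_def by blast+
  qed
  define I' a' where "I' = Pow I - {{}}" and "a' = sd_weight I a"
  define J b where "J = Pow I' - {{}}" and "b = sd_weight I' a'"
  have a': "weights S I' a'" unfolding I'_def a'_def by (rule weights_sd[OF a])
  have b: "weights S J b" unfolding J_def b_def by (rule weights_sd[OF a'])
  define w where "w \<tau> = com (l ` \<tau>)" for \<tau>
  define u where "u c = com (w ` c)" for c
  \<comment> \<open>A vertex of the least simplex of the chain \<open>c\<close> lies in every member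
    of \<open>c\<close>.\<close>
  define l' where "l' c = l (SOME i. i \<in> \<Inter>c)" for c
  have w: "w \<tau> \<in> V - {v}" "\<And>i. i \<in> \<tau> \<Longrightarrow> adj (w \<tau>) (l i)"
    if x: "x \<in> S" and \<tau>: "\<tau> \<in> active I' a' x" for x \<tau>
  proof -
    have sub: "\<tau> \<subseteq> active I a x" using active_sd_subset(2)[OF a x] \<tau> by (simp add: I'_def a'_def)
    then have "l ` \<tau> \<in> common_nbr_complex adj V" using l[OF x] unfolding common_nbr_complex_def by blast
    moreover have "card (l ` \<tau>) \<le> N"
    proof -
      have "card (l ` \<tau>) \<le> card \<tau>" "card \<tau> \<le> card (active I a x)"
        using sub finite_active[OF a] by (auto intro: card_image_le card_mono finite_subset)
      then show ?thesis using card[OF x] by linarith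
    qed
    ultimately show "w \<tau> \<in> V - {v}" "\<And>i. i \<in> \<tau> \<Longrightarrow> adj (w \<tau>) (l i)"
      unfolding w_def using com by blast+
  qed
  have c: "c \<subseteq> active I' a' x" "c \<noteq> {}" "\<Inter>c \<in> c" "(SOME i. i \<in> \<Inter>c) \<in> \<Inter>c"
    if x: "x \<in> S" and c: "c \<in> active J b x" for x c
  proof -
    show sub: "c \<subseteq> active I' a' x" and ne: "c \<noteq> {}"
      using active_sd_subset[OF a' x] c by (simp_all add: J_def b_def)
    then show "\<Inter>c \<in> c"
      using active_sd(2)[OF a x] by (simp add: I'_def a'_def)
    then have "\<Inter>c \<noteq> {}" using sub active_sd_subset(1)[OF a x] by (auto simp: I'_def a'_def)
    then show "(SOME i. i \<in> \<Inter>c) \<in> \<Inter>c" using someI_ex[of "\<lambda>i. i \<in> \<Inter>c"] by blast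
  qed
  have u: "u c \<in> V - {v}" "\<And>\<tau>. \<tau> \<in> c \<Longrightarrow> adj (u c) (w \<tau>)"
    if x: "x \<in> S" and cc: "c \<in> active J b x" for x c
  proof -
    note c = c[OF x cc]
    obtain i where i: "i \<in> \<Inter>c" using c(4) by blast
    then have "i \<in> active I a x"
      using c active_sd_subset(2)[OF a x] unfolding I'_def a'_def by blast
    then have "l i \<in> V" using l[OF x] unfolding common_nbr_complex_def by blast
    moreover have "adj (l i) (w \<tau>)" "w \<tau> \<in> V" if "\<tau> \<in> c" for \<tau>
      using w[OF x, of \<tau>] that i c(1) sym by blast+
    ultimately have "w ` c \<in> common_nbr_complex adj V" unfolding common_nbr_complex_def by blast
    moreover have "card (w ` c) \<le> N"
    proof -
      have "card (w ` c) \<le> card c" "card c \<le> card (active I' a' x)"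
        using c(1) finite_active[OF a'] by (auto intro: card_image_le card_mono finite_subset)
      moreover have "card (active I' a' x) \<le> card (active I a x)"
        unfolding I'_def a'_def by (rule active_sd(1)[OF a x])
      ultimately show ?thesis using card[OF x] by linarith
    qed
    ultimately show "u c \<in> V - {v}" "\<And>\<tau>. \<tau> \<in> c \<Longrightarrow> adj (u c) (w \<tau>)"
      unfolding u_def using com by blast+
  qed
  show thesis
  proof
    show "weights S J b" by (rule b)
    fix x assume x: "x \<in> S"
    \<comment> \<open>The active chains are nested; a simplex \<open>\<tau>\<close> in the least of
      them belongs to all, and \<open>w \<tau>\<close> becomes the common neighbour for every claim
      below.\<close>
    have "\<Inter>(active J b x) \<in> active J b x"
      using active_sd(2)[OF a' x subset_refl] active_nonempty[OF b x] by (simp add: J_def b_def)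
    from c(1,2)[OF x this] obtain \<tau> where \<tau>: "\<tau> \<in> active I' a' x" "\<And>c. c \<in> active J b x \<Longrightarrow> \<tau> \<in> c"
      by blast
    have adj_u: "adj (w \<tau>) (u c)" "u c \<in> V - {v}" if "c \<in> active J b x" for c
      using u[OF x that] \<tau>(2)[OF that] sym by blast+
    have l'_eq: "l' c \<in> l ` \<tau>" if "c \<in> active J b x" for c
      using c(4)[OF x that] \<tau>(2)[OF that] unfolding l'_def by blast
    have \<tau>_sub: "\<tau> \<subseteq> active I a x"
      using active_sd_subset(2)[OF a x] \<tau>(1) by (simp add: I'_def a'_def)
    have lV: "l ` active I a x \<subseteq> V" using l[OF x] by (simp add: common_nbr_complex_def)
    have "u ` active J b x \<subseteq> V - {v}"
      by (rule image_subsetI) (rule adj_u(2))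
    moreover have "\<forall>y\<in>u ` active J b x. adj (w \<tau>) y"
      by (auto intro: adj_u(1))
    ultimately show "u ` active J b x \<in> common_nbr_complex adj (V - {v})"
      unfolding common_nbr_complex_def using w(1)[OF x \<tau>(1)] by auto
    have "l' ` active J b x \<subseteq> l ` \<tau>"
      by (rule image_subsetI) (rule l'_eq)
    also have "\<dots> \<subseteq> l ` active I a x"
      using \<tau>_sub by (rule image_mono)
    finally show sub: "l' ` active J b x \<subseteq> l ` active I a x" .
    have "adj (w \<tau>) y" if "y \<in> l' ` active J b x \<union> u ` active J b x" for y
      using that \<open>l' ` active J b x \<subseteq> l ` \<tau>\<close> \<open>\<forall>y\<in>u ` active J b x. adj (w \<tau>) y\<close>
        w(2)[OF x \<tau>(1)] by auto
    moreover have "l' ` active J b x \<union> u ` active J b x \<subseteq> V"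
      using sub lV \<open>u ` active J b x \<subseteq> V - {v}\<close> by auto
    ultimately show "l' ` active J b x \<union> u ` active J b x \<in> common_nbr_complex adj V"
      unfolding common_nbr_complex_def using w(1)[OF x \<tau>(1)] by auto
  qed
qed

section \<open>Filling spheres through the complex without the vertex\<close>

lemma fillable_mono: "fillable d K' f \<Longrightarrow> K' \<subseteq> K \<Longrightarrow> fillable d K f"
  unfolding fillable_def realization_def by blast

lemma fillable_if_avoids_vertex:
  fixes adj :: "'a \<Rightarrow> 'a \<Rightarrow> bool" and V :: "'a set" and v :: 'a
  defines "K \<equiv> common_nbr_complex adj"
  assumes V: "finite V" and sym: "\<And>u w. adj u w \<Longrightarrow> adj w u"
    and repl: "\<And>T. T \<subseteq> V \<Longrightarrow> \<forall>u\<in>T. adj v u \<Longrightarrow> card T \<le> d \<Longrightarrow> \<exists>w\<in>V - {v}. \<forall>u\<in>T. adj w u"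
    and fill: "\<And>h. continuous_on (unit_sphere d) h \<Longrightarrow>
        h \<in> unit_sphere d \<rightarrow> realization (K (V - {v})) \<Longrightarrow> fillable d (K (V - {v})) h"
    and f: "continuous_on (unit_sphere d) f" "f \<in> unit_sphere d \<rightarrow> realization (K V)"
  shows "fillable d (K V) f"
proof -
  let ?S = "unit_sphere d" and ?K' = "K (V - {v})"
  have A: "finite V" "\<Union>(K V) \<subseteq> V" and A': "finite (V - {v})" "\<Union>?K' \<subseteq> V - {v}"
    using V by (auto simp: K_def common_nbr_complex_def)
  have sub: "\<sigma> \<in> K V" if "\<tau> \<in> K V" "\<sigma> \<subseteq> \<tau>" for \<sigma> \<tau>
    using that unfolding K_def common_nbr_complex_def by blast
  have "?K' \<subseteq> K V" unfolding K_def common_nbr_complex_def by blast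
  obtain I :: "(nat \<Rightarrow> int) set" and a l where a: "weights ?S I a"
    and card: "\<And>x. x \<in> ?S \<Longrightarrow> card (active I a x) \<le> d"
    and l: "\<And>x. x \<in> ?S \<Longrightarrow> l ` active I a x \<subseteq> {w. f x w \<noteq> 0}"
    using sphere_approximation[OF f] by blast
  have supp: "{w. f x w \<noteq> 0} \<in> K V" if "x \<in> ?S" for x
    using f(2) that by (auto simp: realization_def)
  have lK: "l ` active I a x \<in> K V" if "x \<in> ?S" for x
    using sub[OF supp l] that by blast
  obtain J :: "(nat \<Rightarrow> int) set set set" and b u l' where b: "weights ?S J b"
    and u: "\<And>x. x \<in> ?S \<Longrightarrow> u ` active J b x \<in> ?K'"
    and l'u: "\<And>x. x \<in> ?S \<Longrightarrow> l' ` active J b x \<union> u ` active J b x \<in> K V"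
    and l': "\<And>x. x \<in> ?S \<Longrightarrow> l' ` active J b x \<subseteq> l ` active I a x"
    using avoid_vertex[OF sym repl a card lK[unfolded K_def]] unfolding K_def by blast
  \<comment> \<open>Consecutive maps in \<open>f\<close>, \<open>f1\<close>, \<open>f2\<close>,
    \<open>f3\<close> are contiguous, and \<open>f3\<close> lands in the smaller complex.
    Fillability is carried back from \<open>f3\<close> to \<open>f\<close>.\<close>
  define f1 f2 f3 where "f1 = weighted_map I a l" and "f2 = weighted_map J b l'"
    and "f3 = weighted_map J b u"
  have cont: "continuous_on ?S f1" "continuous_on ?S f2" "continuous_on ?S f3"
    unfolding f1_def f2_def f3_def by (intro continuous_on_weighted_map a b)+
  have "f3 \<in> ?S \<rightarrow> realization ?K'"
    unfolding f3_def using weighted_map_in_realization[OF A' b _ u] by blast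
  then have "fillable d ?K' f3" using fill cont(3) by blast
  then have "fillable d (K V) f3" using \<open>?K' \<subseteq> K V\<close> by (rule fillable_mono)
  then have "fillable d (K V) f2"
  proof (rule fillable_contiguous[OF A sub cont(2), rotated -1])
    show "f2 \<in> ?S \<rightarrow> realization (K V)"
      unfolding f2_def using weighted_map_in_realization[OF A b] sub[OF l'u] by blast
    show "{w. f2 x w \<noteq> 0} \<union> {w. f3 x w \<noteq> 0} \<in> K V" if "x \<in> ?S" for x
      unfolding f2_def f3_def weighted_map_support[OF b that] by (rule l'u[OF that])
  qed
  then have "fillable d (K V) f1"
  proof (rule fillable_contiguous[OF A sub cont(1), rotated -1])
    show "f1 \<in> ?S \<rightarrow> realization (K V)"
      unfolding f1_def using weighted_map_in_realization[OF A a] lK by blast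
    show "{w. f1 x w \<noteq> 0} \<union> {w. f2 x w \<noteq> 0} \<in> K V" if "x \<in> ?S" for x
      unfolding f1_def f2_def weighted_map_support[OF a that] weighted_map_support[OF b that]
      using l'[OF that] lK[OF that] by (simp add: Un_absorb2)
  qed
  then show ?thesis
  proof (rule fillable_contiguous[OF A sub f, rotated -1])
    show "{w. f x w \<noteq> 0} \<union> {w. f1 x w \<noteq> 0} \<in> K V" if "x \<in> ?S" for x
      unfolding f1_def weighted_map_support[OF a that]
      using l[OF that] supp[OF that] by (simp add: Un_absorb2)
  qed
qed

section \<open>Neighbourhood complexes of graphs\<close>

lemma (in graph) neighbourhood_complex_del_vert:
  "neighbourhood_complex (del_vert v) =
     common_nbr_complex (dominates G) (verts G - {v})"
proof -
  have "w \<rightarrow>\<^bsub>del_vert v\<^esub> u \<longleftrightarrow> w \<rightarrow>\<^bsub>G\<^esub> u \<and> w \<noteq> v \<and> u \<noteq> v" for u w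
    by (auto simp: arcs_ends_def arc_to_ends_def del_vert_simps)
  then have nbrs: "neighbours (del_vert v) w = {u \<in> verts G - {v}. w \<rightarrow>\<^bsub>G\<^esub> u}" if "w \<noteq> v" for w
    using that by (auto simp: neighbours_def del_vert_simps)
  show ?thesis
    unfolding neighbourhood_complex_def common_nbr_complex_def verts_del_vert
  proof (intro Collect_cong conj_cong bex_cong refl)
    fix \<sigma> w assume "\<sigma> \<subseteq> verts G - {v}" "w \<in> verts G - {v}"
    moreover from this have "w \<noteq> v" by blast
    ultimately show "\<sigma> \<subseteq> neighbours (del_vert v) w \<longleftrightarrow> (\<forall>u\<in>\<sigma>. w \<rightarrow>\<^bsub>G\<^esub> u)"
      unfolding nbrs[OF \<open>w \<noteq> v\<close>] by (simp add: subset_iff) blast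
  qed
qed

theorem theorem5p1:
  fixes G :: "('a, 'b) pre_digraph" and n :: nat and v :: 'a
  assumes "graph G"
    and "v \<in> verts G"
    and "\<And>S. S \<subseteq> neighbours G v \<Longrightarrow> card S \<le> n + 1 \<Longrightarrow>
           \<exists>w\<in>verts G. w \<noteq> v \<and> S \<subseteq> neighbours G w"
  shows "\<forall>k::int. k \<le> int n \<longrightarrow>
           k_connected_space k (geometric_realization (neighbourhood_complex (pre_digraph.del_vert G v))) \<longrightarrow>
           k_connected_space k (geometric_realization (neighbourhood_complex G))"
proof (intro allI impI)
  interpret graph G by fact
  define K where "K = common_nbr_complex (dominates G)"
  have K: "neighbourhood_complex G = K (verts G)"
    by (auto simp: neighbourhood_complex_def neighbours_def K_def common_nbr_complex_def)
  have K': "neighbourhood_complex (del_vert v) = K (verts G - {v})"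
    by (simp add: neighbourhood_complex_del_vert K_def)
  have sym: "w \<rightarrow>\<^bsub>G\<^esub> u" if "u \<rightarrow>\<^bsub>G\<^esub> w" for u w
    using sym_arcs that by (auto simp: symmetric_def dest: symD)
  fix k :: int
  assume k: "k \<le> int n" and conn: "k_connected_space k (geometric_realization (neighbourhood_complex (del_vert v)))"
  \<comment> \<open>Nonemptiness is inherited from the subcomplex; for negative \<open>k\<close> it
    is the whole claim.\<close>
  have "realization (K (verts G - {v})) \<subseteq> realization (K (verts G))"
    unfolding realization_def K_def common_nbr_complex_def by blast
  then have "realization (K (verts G)) \<noteq> {}"
    using conn by (auto simp: k_connected_space_geometric_realization K')
  moreover have "fillable (Suc m) (K (verts G)) f"
    if m: "int m \<le> k" and f: "continuous_on (unit_sphere (Suc m)) f"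
      "f \<in> unit_sphere (Suc m) \<rightarrow> realization (K (verts G))" for m f
    unfolding K_def
  proof (rule fillable_if_avoids_vertex[where v = v])
    show "\<exists>w\<in>verts G - {v}. \<forall>u\<in>T. w \<rightarrow>\<^bsub>G\<^esub> u"
      if "T \<subseteq> verts G" "\<forall>u\<in>T. v \<rightarrow>\<^bsub>G\<^esub> u" "card T \<le> Suc m" for T
    proof -
      \<comment> \<open>Here \<open>k \<le> n\<close> enters: \<open>m \<le> n\<close> turns the
        bound \<open>Suc m\<close> into \<open>n + 1\<close>.\<close>
      have "\<exists>w\<in>verts G. w \<noteq> v \<and> T \<subseteq> neighbours G w"
        using assms(3)[of T] that m k by (auto simp: neighbours_def)
      then show ?thesis by (auto simp: neighbours_def)
    qed
    show "fillable (Suc m) (common_nbr_complex (dominates G) (verts G - {v})) h"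
      if "continuous_on (unit_sphere (Suc m)) h"
        "h \<in> unit_sphere (Suc m) \<rightarrow>
           realization (common_nbr_complex (dominates G) (verts G - {v}))" for h
      using conn m that unfolding k_connected_space_geometric_realization K' K_def by blast
  qed (use sym f in \<open>auto simp: K_def\<close>)
  ultimately show "k_connected_space k (geometric_realization (neighbourhood_complex G))"
    unfolding k_connected_space_geometric_realization K by blast
qed

end
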